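(* Let $\mathbb{A}\in[0,\pi/2]$ and let $r_1,r_2,r_3\ge 0$ be real numbers, and put $$G=\begin{pmatrix}1&r_3&r_2\\ r_3&1&r_1e^{\mathbf{i}\mathbb{A}}\\ r_2&r_1e^{-\mathbf{i}\mathbb{A}}&1\end{pmatrix}.$$ There exists a quaternionic hyperbolic $(r_1,r_2,r_3;\mathbb{A})$-triangle in $\mathbf{H}^2_{\mathbb{H}}$ if and only if $$\det G=1-(r_1^2+r_2^2+r_3^2)+2r_1r_2r_3\cos\mathbb{A}\le 0.$$ Moreover, for such a triangle with polar vectors $\mathbf{p}_1,\mathbf{p}_2,\mathbf{p}_3$, one has $\det G=0$ if and only if there exist $\lambda_1,\lambda_2,\lambda_3\in\mathbb{H}$ with $\sum_{i=1}^3|\lambda_i|\ne 0$ such that $\mathbf{p}_1\lambda_1+\mathbf{p}_2\lambda_2+\mathbf{p}_3\lambda_3=0$.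
   Context: $\mathbb{H}$ denotes the quaternions. $\mathbb{H}^{2,1}$ is the right $\mathbb{H}$-vector space $\mathbb{H}^3$ with $\langle\mathbf{z},\mathbf{w}\rangle=\mathbf{w}^*J\mathbf{z}$, $J=\mathrm{diag}(1,1,-1)$; $V_-$ (resp. $V_+$) is the set of vectors with $\langle\mathbf{z},\mathbf{z}\rangle<0$ (resp. $>0$), and $\mathbf{H}^2_{\mathbb{H}}=\mathbb{P}(V_-)\subset\mathbb{H}\mathbb{P}^2$. A quaternionic line is a set $l=\mathbb{P}(\mathbf{p}^\perp)\cap\mathbf{H}^2_{\mathbb{H}}$ with $\mathbf{p}\in V_+$; $\mathbf{p}$ (unique up to right multiplication by a nonzero quaternion) is a polar vector of $l$, normalized if $\langle\mathbf{p},\mathbf{p}\rangle=1$. A quaternionic hyperbolic triangle is a triple $(l_1,l_2,l_3)$ of quaternionic lines in $\mathbf{H}^2_{\mathbb{H}}$. It is called an $(r_1,r_2,r_3;\mathbb{A})$-triangle if its lines have normalized polar vectors $\mathbf{p}_1,\mathbf{p}_2,\mathbf{p}_3$ whose Gram matrix $(\langle\mathbf{p}_j,\mathbf{p}_i\rangle)_{i,j}$ equals the matrix $G$ above. *)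

theory Defs
  imports "HOL-Analysis.Analysis"
begin

section \<open>The quaternions as a real normed division algebra\<close>

text \<open>\<open>Quat a b c d\<close> is the quaternion $a + b\,i + c\,j + d\,k$.\<close>

datatype quat = Quat (qre: real) (qi: real) (qj: real) (qk: real)

lemma quat_eq_iff: "x = y \<longleftrightarrow> qre x = qre y \<and> qi x = qi y \<and> qj x = qj y \<and> qk x = qk y"
  by (auto intro: quat.expand)

definition qcnj :: "quat \<Rightarrow> quat" where
  "qcnj x = Quat (qre x) (- qi x) (- qj x) (- qk x)"

definition quat_of_complex :: "complex \<Rightarrow> quat" where
  "quat_of_complex z = Quat (Re z) (Im z) 0 0"

lemma qcnj_sel [simp]:
  "qre (qcnj x) = qre x" "qi (qcnj x) = - qi x" "qj (qcnj x) = - qj x" "qk (qcnj x) = - qk x"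
  by (simp_all add: qcnj_def)

instantiation quat :: ring_1
begin

definition "0 = Quat 0 0 0 0"
definition "1 = Quat 1 0 0 0"
definition "x + y = Quat (qre x + qre y) (qi x + qi y) (qj x + qj y) (qk x + qk y)"
definition "x - y = Quat (qre x - qre y) (qi x - qi y) (qj x - qj y) (qk x - qk y)"
definition "- x = Quat (- qre x) (- qi x) (- qj x) (- qk x)"
definition "x * y = Quat
  (qre x * qre y - qi x * qi y - qj x * qj y - qk x * qk y)
  (qre x * qi y + qi x * qre y + qj x * qk y - qk x * qj y)
  (qre x * qj y - qi x * qk y + qj x * qre y + qk x * qi y)
  (qre x * qk y + qi x * qj y - qj x * qi y + qk x * qre y)"

lemmas quat_ring_defs =
  zero_quat_def one_quat_def plus_quat_def minus_quat_def uminus_quat_def times_quat_def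

instance
  by standard (simp_all add: quat_eq_iff quat_ring_defs algebra_simps)

end

lemma quat_ring_sel [simp]:
  "qre 0 = 0" "qi 0 = 0" "qj 0 = 0" "qk 0 = 0"
  "qre 1 = 1" "qi 1 = 0" "qj 1 = 0" "qk 1 = 0"
  "qre (x + y) = qre x + qre y" "qi (x + y) = qi x + qi y"
  "qj (x + y) = qj x + qj y" "qk (x + y) = qk x + qk y"
  "qre (x - y) = qre x - qre y" "qi (x - y) = qi x - qi y"
  "qj (x - y) = qj x - qj y" "qk (x - y) = qk x - qk y"
  "qre (- x) = - qre x" "qi (- x) = - qi x" "qj (- x) = - qj x" "qk (- x) = - qk x"
  "qre (x * y) = qre x * qre y - qi x * qi y - qj x * qj y - qk x * qk y"
  "qi (x * y) = qre x * qi y + qi x * qre y + qj x * qk y - qk x * qj y"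
  "qj (x * y) = qre x * qj y - qi x * qk y + qj x * qre y + qk x * qi y"
  "qk (x * y) = qre x * qk y + qi x * qj y - qj x * qi y + qk x * qre y"
  by (simp_all add: quat_ring_defs)

instantiation quat :: real_algebra_1
begin

definition "scaleR r x = Quat (r * qre x) (r * qi x) (r * qj x) (r * qk x)"

lemma scaleR_quat_sel [simp]:
  "qre (r *\<^sub>R x) = r * qre x" "qi (r *\<^sub>R x) = r * qi x"
  "qj (r *\<^sub>R x) = r * qj x" "qk (r *\<^sub>R x) = r * qk x"
  by (simp_all add: scaleR_quat_def)

instance
  by standard (simp_all add: quat_eq_iff algebra_simps)

end

instantiation quat :: real_normed_div_algebra
begin

definition norm_quat :: "quat \<Rightarrow> real" where
  "norm_quat x = sqrt ((qre x)\<^sup>2 + (qi x)\<^sup>2 + (qj x)\<^sup>2 + (qk x)\<^sup>2)"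
definition "sgn (x::quat) = x /\<^sub>R norm x"
definition "dist x (y::quat) = norm (x - y)"
definition [code del]:
  "(uniformity :: (quat \<times> quat) filter) = (INF e\<in>{0 <..}. principal {(x, y). dist x y < e})"
definition [code del]:
  "open (U :: quat set) \<longleftrightarrow> (\<forall>x\<in>U. eventually (\<lambda>(x', y). x' = x \<longrightarrow> y \<in> U) uniformity)"
definition "inverse x = qcnj x /\<^sub>R (norm x)\<^sup>2"
definition "x div (y::quat) = x * inverse y"

lemma norm_quat_sq: "(norm (x::quat))\<^sup>2 = (qre x)\<^sup>2 + (qi x)\<^sup>2 + (qj x)\<^sup>2 + (qk x)\<^sup>2"
  by (simp add: norm_quat_def)

lemma norm_quat_zero_iff: "norm (x::quat) = 0 \<longleftrightarrow> x = 0"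
  by (auto simp: norm_quat_def quat_eq_iff add_nonneg_eq_0_iff)

lemma norm_quat_eq_4: "norm (x::quat) = norm ((qre x, qi x), (qj x, qk x))"
  by (simp add: norm_quat_def norm_prod_def algebra_simps)

instance
proof
  fix a b :: real and x y z :: quat
  show "norm x = 0 \<longleftrightarrow> x = 0" by (rule norm_quat_zero_iff)
  have "((qre (x + y), qi (x + y)), (qj (x + y), qk (x + y)))
        = ((qre x, qi x), (qj x, qk x)) + ((qre y, qi y), (qj y, qk y))"
    by simp
  then show "norm (x + y) \<le> norm x + norm y"
    unfolding norm_quat_eq_4 by (metis norm_triangle_ineq)
  have "(norm (a *\<^sub>R x))\<^sup>2 = (\<bar>a\<bar> * norm x)\<^sup>2"
    by (simp add: norm_quat_sq power_mult_distrib algebra_simps)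
  then show "norm (a *\<^sub>R x) = \<bar>a\<bar> * norm x"
    by (rule power2_eq_imp_eq) (simp_all add: norm_quat_def)
  have "(norm (x * y))\<^sup>2 = (norm x * norm y)\<^sup>2"
    unfolding power_mult_distrib norm_quat_sq quat_ring_sel by algebra
  then show "norm (x * y) = norm x * norm y"
    by (rule power2_eq_imp_eq) (simp_all add: norm_quat_def)
  show "x \<noteq> 0 \<Longrightarrow> inverse x * x = 1" "x \<noteq> 0 \<Longrightarrow> x * inverse x = 1"
  proof -
    assume "x \<noteq> 0"
    then have nz: "(norm x)\<^sup>2 \<noteq> 0" by (simp add: norm_quat_zero_iff)
    have "qcnj x * x = (norm x)\<^sup>2 *\<^sub>R 1" "x * qcnj x = (norm x)\<^sup>2 *\<^sub>R 1"
      unfolding norm_quat_sq by (simp_all add: quat_eq_iff power2_eq_square)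
    with nz show "inverse x * x = 1" "x * inverse x = 1"
      by (simp_all add: inverse_quat_def)
  qed
  show "inverse (0::quat) = 0" by (simp add: inverse_quat_def quat_eq_iff)
qed (simp_all add: sgn_quat_def dist_quat_def uniformity_quat_def open_quat_def divide_quat_def)

end


section \<open>The quaternionic hyperbolic plane\<close>

definition rscale :: "quat ^ 'n \<Rightarrow> quat \<Rightarrow> quat ^ 'n"  (infixl "\<cdot>" 75) where
  "z \<cdot> q = (\<chi> i. z $ i * q)"

text \<open>The Hermitian form $\langle z,w\rangle = w^* J z$ with $J = \mathrm{diag}(1,1,-1)$.\<close>

definition herm :: "quat ^ 3 \<Rightarrow> quat ^ 3 \<Rightarrow> quat" where
  "herm z w = qcnj (w $ 1) * z $ 1 + qcnj (w $ 2) * z $ 2 - qcnj (w $ 3) * z $ 3"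

text \<open>\<open>herm z z\<close> is always real, so the sign of $\langle z,z\rangle$ is that of its real part.\<close>

lemma herm_self_real: "herm z z = of_real (qre (herm z z))"
  by (simp add: herm_def quat_eq_iff of_real_def)

definition V_neg :: "(quat ^ 3) set" where
  "V_neg = {z. qre (herm z z) < 0}"

definition V_pos :: "(quat ^ 3) set" where
  "V_pos = {z. qre (herm z z) > 0}"

text \<open>A point of the projective plane is a one-dimensional right subspace of $H^3$, so subsets
  of the projective plane have type \<open>(quat ^ 3) set set\<close>.\<close>

definition proj_pt :: "quat ^ 3 \<Rightarrow> (quat ^ 3) set" where
  "proj_pt z = range (\<lambda>q. z \<cdot> q)"

definition proj :: "(quat ^ 3) set \<Rightarrow> (quat ^ 3) set set" where
  "proj S = proj_pt ` (S - {0})"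

definition hyp_plane :: "(quat ^ 3) set set" where
  "hyp_plane = proj V_neg"

definition perp :: "quat ^ 3 \<Rightarrow> (quat ^ 3) set" where
  "perp p = {z. herm z p = 0}"

definition polar_vector :: "quat ^ 3 \<Rightarrow> (quat ^ 3) set set \<Rightarrow> bool" where
  "polar_vector p l \<longleftrightarrow> p \<in> V_pos \<and> l = proj (perp p) \<inter> hyp_plane"

definition normalized_polar_vector :: "quat ^ 3 \<Rightarrow> (quat ^ 3) set set \<Rightarrow> bool" where
  "normalized_polar_vector p l \<longleftrightarrow> polar_vector p l \<and> herm p p = 1"

definition quat_line :: "(quat ^ 3) set set \<Rightarrow> bool" where
  "quat_line l \<longleftrightarrow> (\<exists>p. polar_vector p l)"

type_synonym line_triple = "(quat ^ 3) set set \<times> (quat ^ 3) set set \<times> (quat ^ 3) set set"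

definition hyp_triangle :: "line_triple \<Rightarrow> bool" where
  "hyp_triangle = (\<lambda>(l1, l2, l3). quat_line l1 \<and> quat_line l2 \<and> quat_line l3)"


section \<open>Triangles with prescribed Gram matrix\<close>

definition G_matrix :: "real \<Rightarrow> real \<Rightarrow> real \<Rightarrow> real \<Rightarrow> complex ^ 3 ^ 3" where
  "G_matrix r1 r2 r3 A = vector
    [vector [1, of_real r3, of_real r2],
     vector [of_real r3, 1, of_real r1 * exp (\<i> * of_real A)],
     vector [of_real r2, of_real r1 * exp (- \<i> * of_real A), 1]]"

definition gram :: "quat ^ 3 \<Rightarrow> quat ^ 3 \<Rightarrow> quat ^ 3 \<Rightarrow> quat ^ 3 ^ 3" where
  "gram p1 p2 p3 = (let p = vector [p1, p2, p3] :: (quat ^ 3) ^ 3 in \<chi> i j. herm (p $ j) (p $ i))"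

definition rA_triangle :: "real \<Rightarrow> real \<Rightarrow> real \<Rightarrow> real \<Rightarrow> line_triple \<Rightarrow> bool" where
  "rA_triangle r1 r2 r3 A = (\<lambda>(l1, l2, l3).
     hyp_triangle (l1, l2, l3) \<and>
     (\<exists>p1 p2 p3. normalized_polar_vector p1 l1 \<and> normalized_polar_vector p2 l2 \<and>
        normalized_polar_vector p3 l3 \<and>
        gram p1 p2 p3 = (\<chi> i j. quat_of_complex (G_matrix r1 r2 r3 A $ i $ j))))"

end

theory Submission
  imports Defs
begin

text \<open>Splitting off \<open>p1\<close> by Gram-Schmidt turns the Gram matrix into a \<open>2 \<times> 2\<close> Schur complement
  with the same determinant. If that determinant is positive, the Schur complement is definite,
  which the signature \<open>(2, 1)\<close> forbids; if it is nonpositive, the Schur complement can be realized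
  by hand in signature \<open>(1, 1)\<close>. When the determinant vanishes, a kernel vector of the Gram matrix
  gives a combination of the \<open>p\<^sub>i\<close> orthogonal to all of them, which is either zero or confines them
  to a plane. Linear dependence does not depend on the choice of polar vectors, because a polar
  vector is determined up to scaling: the negative vectors in its orthogonal complement span it.\<close>

section \<open>Conjugation on the quaternions and the sesquilinear form \<open>herm\<close>\<close>

lemma qcnj_ring [simp]:
  "qcnj 0 = 0" "qcnj 1 = 1" "qcnj (x + y) = qcnj x + qcnj y" "qcnj (x - y) = qcnj x - qcnj y"
  "qcnj (- x) = - qcnj x" "qcnj (x * y) = qcnj y * qcnj x" "qcnj (qcnj x) = x"
  by (simp_all add: quat_eq_iff algebra_simps)

lemma of_real_quat: "of_real r = Quat r 0 0 0"
  by (simp add: of_real_def quat_eq_iff)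

lemma of_real_quat_sel [simp]:
  "qre (of_real r) = r" "qi (of_real r) = 0" "qj (of_real r) = 0" "qk (of_real r) = 0"
  by (simp_all add: of_real_quat)

lemma qcnj_of_real [simp]: "qcnj (of_real r) = of_real r"
  by (simp add: quat_eq_iff)

lemma qcnj_eq_0_iff [simp]: "qcnj x = 0 \<longleftrightarrow> x = 0"
  by (simp add: quat_eq_iff)

lemma qcnj_mult_self: "qcnj x * x = of_real ((norm x)\<^sup>2)"
  unfolding norm_quat_sq by (simp add: quat_eq_iff power2_eq_square)

lemma qcnj_mult_real_mult_self: "qcnj x * of_real r * x = of_real ((norm x)\<^sup>2 * r)"
  unfolding norm_quat_sq
  by (simp add: quat_eq_iff power2_eq_square algebra_simps
      del: of_real_mult of_real_add of_real_power)

lemma rscale_nth [simp]: "(z \<cdot> q) $ i = z $ i * q"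
  by (simp add: rscale_def)

lemma rscale_rscale: "z \<cdot> q \<cdot> r = z \<cdot> (q * r)"
  by (simp add: vec_eq_iff mult.assoc)

lemma rscale_1 [simp]: "z \<cdot> 1 = z"
  by (simp add: vec_eq_iff)

lemma herm_add_left: "herm (z + w) u = herm z u + herm w u"
  by (simp add: herm_def algebra_simps)

lemma herm_diff_left: "herm (z - w) u = herm z u - herm w u"
  by (simp add: herm_def algebra_simps)

lemma herm_scale_left: "herm (z \<cdot> q) u = herm z u * q"
  by (simp add: herm_def algebra_simps)

lemma herm_add_right: "herm u (z + w) = herm u z + herm u w"
  by (simp add: herm_def algebra_simps)

lemma herm_diff_right: "herm u (z - w) = herm u z - herm u w"
  by (simp add: herm_def algebra_simps)

lemma herm_scale_right: "herm u (z \<cdot> q) = qcnj q * herm u z"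
  by (simp add: herm_def algebra_simps)

lemma qcnj_herm: "qcnj (herm z w) = herm w z"
  by (simp add: herm_def)

lemmas herm_sesqui = herm_add_left herm_diff_left herm_scale_left
  herm_add_right herm_diff_right herm_scale_right

lemma herm_eq_0_sym: "herm z w = 0 \<longleftrightarrow> herm w z = 0"
  by (metis qcnj_herm qcnj_eq_0_iff)

lemma qre_herm_self: "qre (herm z z) = (norm (z $ 1))\<^sup>2 + (norm (z $ 2))\<^sup>2 - (norm (z $ 3))\<^sup>2"
  by (simp add: herm_def qcnj_mult_self del: of_real_power)

text \<open>Pairing with a standard basis vector returns a coordinate up to sign.\<close>

lemma herm_nondegenerate:
  assumes "\<And>w. herm z w = 0"
  shows "z = 0"
proof -
  have "herm z (axis k 1) = (if k = 3 then - z $ k else z $ k)" for k :: 3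
    using exhaust_3[of k] by (auto simp: herm_def axis_def)
  then show ?thesis
    using assms by (metis neg_equal_0_iff_equal vec_eq_iff zero_index)
qed

section \<open>Polar vectors\<close>

text \<open>Orthogonality to \<open>p\<close> survives right scaling, so the choice of
  representative of the point does not matter.\<close>

lemma in_proj_perp_iff:
  assumes "z \<noteq> 0"
  shows "proj_pt z \<in> proj (perp p) \<longleftrightarrow> herm z p = 0"
proof
  assume "proj_pt z \<in> proj (perp p)"
  then obtain w where w: "herm w p = 0" "proj_pt z = proj_pt w"
    by (auto simp: proj_def perp_def)
  have "z \<in> proj_pt z"
    unfolding proj_pt_def by (metis rangeI rscale_1)
  then obtain q where "z = w \<cdot> q"
    using w(2) by (auto simp: proj_pt_def)
  with w(1) show "herm z p = 0"
    by (simp add: herm_scale_left)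
next
  assume "herm z p = 0"
  with assms show "proj_pt z \<in> proj (perp p)"
    by (auto simp: proj_def perp_def)
qed

text \<open>A line is only a set of negative points, so it transfers orthogonality directly for
  negative vectors alone; \<open>same_line_perp\<close> lifts the restriction.\<close>

lemma same_line_perp_neg:
  assumes "polar_vector p l" "polar_vector p' l" "qre (herm z z) < 0" "herm z p = 0"
  shows "herm z p' = 0"
proof -
  have z: "z \<noteq> 0"
    using assms(3) by (auto simp: herm_def)
  have "proj_pt z \<in> hyp_plane"
    using assms(3) z by (auto simp: hyp_plane_def proj_def V_neg_def)
  then have "proj_pt z \<in> l"
    using assms(1,4) z by (simp add: polar_vector_def in_proj_perp_iff)
  then show ?thesis
    using assms(2) z by (simp add: polar_vector_def in_proj_perp_iff)
qed

text \<open>Gram-Schmidt; scalars act on the right, which dictates the order of the factors in the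
  coefficient.\<close>

lemma project_perp:
  assumes "herm p p \<noteq> 0"
  shows "herm (z - p \<cdot> (inverse (herm p p) * herm z p)) p = 0"
  using assms by (simp add: herm_sesqui flip: mult.assoc)

text \<open>Project the negative basis vector \<open>axis 3 1\<close> off \<open>p\<close>. As
  \<open>p\<close> is positive, this can only lower the value -1 of the form.\<close>

lemma perp_contains_neg:
  assumes "p \<in> V_pos"
  obtains n where "herm n p = 0" "qre (herm n n) < 0"
proof
  let ?s = "qre (herm p p)" and ?e = "axis 3 1 :: quat ^ 3"
  let ?n = "?e - p \<cdot> (inverse (herm p p) * herm ?e p)"
  have s: "?s > 0"
    using assms by (simp add: V_pos_def)
  then have nz: "herm p p \<noteq> 0"
    by auto
  show perp: "herm ?n p = 0"
    by (rule project_perp[OF nz])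
  have "herm ?n ?n = herm ?n ?e"
    using perp by (simp add: herm_diff_right[of _ ?e] herm_scale_right)
  also have "\<dots> = herm ?e ?e - qcnj (herm ?e p) * inverse (herm p p) * herm ?e p"
    by (simp add: herm_sesqui qcnj_herm mult.assoc)
  also have "\<dots> = - 1 - of_real ((norm (herm ?e p))\<^sup>2 / ?s)"
  proof -
    have "herm ?e ?e = -1"
      by (simp add: herm_def axis_def)
    moreover have "inverse (herm p p) = of_real (inverse ?s)"
      by (subst herm_self_real) simp
    ultimately show ?thesis
      by (simp only: qcnj_mult_real_mult_self) (simp add: divide_inverse)
  qed
  finally have "qre (herm ?n ?n) = - 1 - (norm (herm ?e p))\<^sup>2 / ?s"
    by (metis of_real_quat_sel(1) of_real_1 of_real_diff of_real_minus)
  moreover have "0 \<le> (norm (herm ?e p))\<^sup>2 / ?s"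
    using s by simp
  ultimately show "qre (herm ?n ?n) < 0"
    by linarith
qed

lemma small_perturbation_neg:
  fixes s c d :: real
  assumes "s < 0"
  obtains t where "t \<noteq> 0" "s + t * c + t\<^sup>2 * d < 0"
proof -
  have "((\<lambda>t. s + t * c + t\<^sup>2 * d) \<longlongrightarrow> s + 0 * c + 0\<^sup>2 * d) (at 0)"
    by (intro tendsto_intros)
  then have "\<forall>\<^sub>F t in at 0. s + t * c + t\<^sup>2 * d < 0"
    using assms by (auto dest: order_tendstoD)
  moreover have "\<forall>\<^sub>F t in at (0::real). t \<noteq> 0"
    by (simp add: eventually_at_filter)
  ultimately have "\<forall>\<^sub>F t in at (0::real). t \<noteq> 0 \<and> s + t * c + t\<^sup>2 * d < 0"
    by eventually_elim simp
  then show ?thesis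
    using that eventually_happens[of _ "at (0::real)"] by auto
qed

text \<open>Moving a negative vector \<open>n\<close> of \<open>perp p\<close> by a small nonzero
  multiple of \<open>w\<close> keeps it negative and in \<open>perp p\<close>. Both \<open>n\<close>
  and the moved vector are then orthogonal to \<open>p'\<close>, hence so is
  \<open>w\<close>.\<close>

lemma same_line_perp:
  assumes "polar_vector p l" "polar_vector p' l" "herm w p = 0"
  shows "herm w p' = 0"
proof -
  obtain n where n: "herm n p = 0" "qre (herm n n) < 0"
    using assms(1) perp_contains_neg by (auto simp: polar_vector_def)
  obtain t where t: "t \<noteq> 0"
    "qre (herm n n) + t * (qre (herm n w) + qre (herm w n)) + t\<^sup>2 * qre (herm w w) < 0"
    using small_perturbation_neg[OF n(2)] by blast
  let ?z = "n + w \<cdot> of_real t"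
  have "qre (herm ?z ?z) < 0"
    using t(2) by (simp add: herm_sesqui power2_eq_square algebra_simps)
  moreover have "herm ?z p = 0"
    using n(1) assms(3) by (simp add: herm_sesqui)
  ultimately have "herm ?z p' = 0"
    using same_line_perp_neg assms(1,2) by blast
  moreover have "herm n p' = 0"
    using same_line_perp_neg assms(1,2) n by blast
  ultimately show ?thesis
    using t(1) by (simp add: herm_sesqui)
qed

text \<open>The part \<open>?d\<close> of \<open>p'\<close> orthogonal to \<open>p\<close> is also
  orthogonal to all of \<open>perp p\<close>, because \<open>perp p\<close> lies in
  \<open>perp p'\<close>. Together with \<open>p\<close> this is the whole space, so
  \<open>?d\<close> vanishes by nondegeneracy.\<close>

lemma polar_vector_unique:
  assumes "polar_vector p l" "polar_vector p' l"
  obtains q where "q \<noteq> 0" "p' = p \<cdot> q"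
proof -
  have nz: "herm p p \<noteq> 0" "herm p' p' \<noteq> 0"
    using assms by (auto simp: polar_vector_def V_pos_def)
  let ?q = "inverse (herm p p) * herm p' p"
  let ?d = "p' - p \<cdot> ?q"
  have dp: "herm ?d p = 0"
    by (rule project_perp[OF nz(1)])
  have "herm ?d w = 0" for w
  proof -
    let ?w = "w - p \<cdot> (inverse (herm p p) * herm w p)"
    have wp: "herm ?w p = 0"
      by (rule project_perp[OF nz(1)])
    then have "herm ?w p' = 0"
      using same_line_perp assms by blast
    with wp have "herm ?w ?d = 0"
      by (simp add: herm_diff_right[of _ p'] herm_scale_right)
    then have "herm ?d ?w = 0"
      using herm_eq_0_sym by blast
    then show ?thesis
      using dp by (simp add: herm_diff_right[of _ w] herm_scale_right)
  qed
  then have "p' = p \<cdot> ?q"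
    using herm_nondegenerate[of ?d] by simp
  moreover have "?q \<noteq> 0"
    using calculation nz(2) by (auto simp: herm_def)
  ultimately show ?thesis
    using that by blast
qed

section \<open>Linear dependence and change of polar vectors\<close>

definition right_dependent :: "quat ^ 3 \<Rightarrow> quat ^ 3 \<Rightarrow> quat ^ 3 \<Rightarrow> bool" where
  "right_dependent p1 p2 p3 \<longleftrightarrow> (\<exists>q1 q2 q3. norm q1 + norm q2 + norm q3 \<noteq> 0 \<and>
     p1 \<cdot> q1 + p2 \<cdot> q2 + p3 \<cdot> q3 = 0)"

lemma norm_sum3_eq_0_iff:
  "norm (a::'a::real_normed_vector) + norm b + norm c = 0 \<longleftrightarrow> a = 0 \<and> b = 0 \<and> c = 0"
  by (simp add: add_nonneg_eq_0_iff)

lemma right_dependent_rescale: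
  assumes "right_dependent (p1 \<cdot> a1) (p2 \<cdot> a2) (p3 \<cdot> a3)" "a1 \<noteq> 0" "a2 \<noteq> 0" "a3 \<noteq> 0"
  shows "right_dependent p1 p2 p3"
proof -
  obtain q1 q2 q3 where "norm q1 + norm q2 + norm q3 \<noteq> 0"
    "p1 \<cdot> (a1 * q1) + p2 \<cdot> (a2 * q2) + p3 \<cdot> (a3 * q3) = 0"
    using assms(1) by (auto simp: right_dependent_def rscale_rscale)
  moreover from this have "norm (a1 * q1) + norm (a2 * q2) + norm (a3 * q3) \<noteq> 0"
    using assms(2-4) unfolding norm_sum3_eq_0_iff by simp
  ultimately show ?thesis
    unfolding right_dependent_def by blast
qed

text \<open>The theorem allows arbitrary polar vectors, whereas the Gram matrix is known for
  normalized ones; this passes between the two.\<close>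

lemma right_dependent_polar:
  assumes "polar_vector p1 l1" "polar_vector p2 l2" "polar_vector p3 l3"
    and "polar_vector p1' l1" "polar_vector p2' l2" "polar_vector p3' l3"
    and "right_dependent p1' p2' p3'"
  shows "right_dependent p1 p2 p3"
proof -
  obtain a1 a2 a3 where "a1 \<noteq> 0" "a2 \<noteq> 0" "a3 \<noteq> 0"
    "p1' = p1 \<cdot> a1" "p2' = p2 \<cdot> a2" "p3' = p3 \<cdot> a3"
    using polar_vector_unique[OF assms(1,4)] polar_vector_unique[OF assms(2,5)]
      polar_vector_unique[OF assms(3,6)] by metis
  with assms(7) show ?thesis
    using right_dependent_rescale by blast
qed

section \<open>The Gram matrix\<close>

text \<open>Gaussian elimination, with unknowns on the right to match right scaling. It supplies
  nontrivial combinations of three vectors subject to two linear conditions.\<close>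

lemma kernel_2_3:
  fixes a1 b1 c1 a2 b2 c2 :: "'a::division_ring"
  obtains x y z where "x \<noteq> 0 \<or> y \<noteq> 0 \<or> z \<noteq> 0"
    "a1 * x + b1 * y + c1 * z = 0" "a2 * x + b2 * y + c2 * z = 0"
proof -
  have one: "\<exists>y z. (y \<noteq> 0 \<or> z \<noteq> 0) \<and> b * y + c * z = 0" for b c :: 'a
  proof (cases "b = 0")
    case True
    then show ?thesis
      by (intro exI[of _ 1] exI[of _ 0]) simp
  next
    case False
    then show ?thesis
      by (intro exI[of _ "- (inverse b * c)"] exI[of _ 1]) (simp flip: mult.assoc)
  qed
  have two: "\<exists>x y z. (x \<noteq> 0 \<or> y \<noteq> 0 \<or> z \<noteq> 0) \<and> a * x + b * y + c * z = 0 \<and> a' * x + b' * y + c' * z = 0"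
    if a: "a \<noteq> 0" for a b c a' b' c' :: 'a
  proof -
    \<comment> \<open>This is the second row after clearing its first entry with the pivot
      \<open>a\<close>.\<close>
    obtain y z where yz: "y \<noteq> 0 \<or> z \<noteq> 0"
      "(b' - a' * (inverse a * b)) * y + (c' - a' * (inverse a * c)) * z = 0"
      using one by blast
    define x where "x = - (inverse a * (b * y + c * z))"
    have "a * x = - (b * y + c * z)"
      using a by (simp add: x_def flip: mult.assoc)
    then have "a * x + b * y + c * z = 0"
      by (simp add: eq_neg_iff_add_eq_0 add.assoc)
    moreover have "a' * x + b' * y + c' * z = 0"
      using yz(2) by (simp add: x_def algebra_simps)
    ultimately show ?thesis
      using yz(1) by blast
  qed
  consider "a1 \<noteq> 0" | "a2 \<noteq> 0" | "a1 = 0" "a2 = 0"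
    by blast
  then show ?thesis
  proof cases
    case 1
    then show ?thesis using two that by blast
  next
    case 2
    then show ?thesis using two that by blast
  next
    case 3
    then show ?thesis using that[of 1 0 0] by simp
  qed
qed

text \<open>Hermitian symmetry supplies the other off-diagonal entries. In the application
  \<open>x\<close>, \<open>y\<close>, \<open>h\<close> are \<open>r3\<close>, \<open>r2\<close> and
  \<open>r1 * cis A\<close>.\<close>

definition has_gram :: "real \<Rightarrow> real \<Rightarrow> quat \<Rightarrow> quat ^ 3 \<Rightarrow> quat ^ 3 \<Rightarrow> quat ^ 3 \<Rightarrow> bool" where
  "has_gram x y h p1 p2 p3 \<longleftrightarrow>
     herm p1 p1 = 1 \<and> herm p2 p2 = 1 \<and> herm p3 p3 = 1 \<and>
     herm p2 p1 = of_real x \<and> herm p3 p1 = of_real y \<and> herm p3 p2 = h"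

text \<open>The usual 3 by 3 determinant makes sense here: the only possibly nonreal entries are
  \<open>h\<close> and its conjugate, which commute.\<close>

definition gram_det :: "real \<Rightarrow> real \<Rightarrow> quat \<Rightarrow> real" where
  "gram_det x y h = 1 - x\<^sup>2 - y\<^sup>2 - (norm h)\<^sup>2 + 2 * x * y * qre h"

text \<open>The right side is the determinant of the Schur complement left after eliminating
  \<open>p1\<close>.\<close>

lemma gram_det_schur: "gram_det x y h = (1 - x\<^sup>2) * (1 - y\<^sup>2) - (norm (h - of_real (x * y)))\<^sup>2"
  unfolding gram_det_def norm_quat_sq by (simp del: of_real_mult) algebra

lemma herm_comb:
  assumes "has_gram x y h p1 p2 p3"
  defines "v \<equiv> \<lambda>l1 l2 l3. p1 \<cdot> l1 + p2 \<cdot> l2 + p3 \<cdot> l3"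
  shows "herm (v l1 l2 l3) p1 = l1 + of_real x * l2 + of_real y * l3"
    and "herm (v l1 l2 l3) p2 = of_real x * l1 + l2 + h * l3"
    and "herm (v l1 l2 l3) p3 = of_real y * l1 + qcnj h * l2 + l3"
proof -
  have "herm p1 p2 = of_real x" "herm p1 p3 = of_real y" "herm p2 p3 = qcnj h"
    using assms(1) by (metis has_gram_def qcnj_herm qcnj_of_real)+
  then show "herm (v l1 l2 l3) p1 = l1 + of_real x * l2 + of_real y * l3"
    "herm (v l1 l2 l3) p2 = of_real x * l1 + l2 + h * l3"
    "herm (v l1 l2 l3) p3 = of_real y * l1 + qcnj h * l2 + l3"
    using assms(1) by (simp_all add: has_gram_def v_def herm_sesqui)
qed

text \<open>Complete the square first in \<open>l1\<close>, then in \<open>l2\<close>. Multiplying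
  through by \<open>1 - x\<^sup>2\<close> avoids division and leaves its sign open.\<close>

lemma gram_form_square:
  "(1 - x\<^sup>2) * qre (qcnj l1 * (l1 + of_real x * l2 + of_real y * l3)
      + qcnj l2 * (of_real x * l1 + l2 + h * l3) + qcnj l3 * (of_real y * l1 + qcnj h * l2 + l3)) =
    (1 - x\<^sup>2) * (norm (l1 + of_real x * l2 + of_real y * l3))\<^sup>2
    + (norm (of_real (1 - x\<^sup>2) * l2 + (h - of_real (x * y)) * l3))\<^sup>2
    + gram_det x y h * (norm l3)\<^sup>2"
  unfolding gram_det_def norm_quat_sq
  by (simp del: of_real_mult of_real_diff of_real_power)
    (simp add: power2_eq_square algebra_simps)

lemma herm_comb_square:
  fixes l1 l2 l3 :: quat
  assumes "has_gram x y h p1 p2 p3"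
  defines "v \<equiv> p1 \<cdot> l1 + p2 \<cdot> l2 + p3 \<cdot> l3"
  shows "(1 - x\<^sup>2) * qre (herm v v) =
    (1 - x\<^sup>2) * (norm (l1 + of_real x * l2 + of_real y * l3))\<^sup>2
    + (norm (of_real (1 - x\<^sup>2) * l2 + (h - of_real (x * y)) * l3))\<^sup>2
    + gram_det x y h * (norm l3)\<^sup>2"
proof -
  have "herm v v = qcnj l1 * herm v p1 + qcnj l2 * herm v p2 + qcnj l3 * herm v p3"
    by (simp add: v_def herm_add_right herm_scale_right)
  also have "\<dots> = qcnj l1 * (l1 + of_real x * l2 + of_real y * l3)
      + qcnj l2 * (of_real x * l1 + l2 + h * l3) + qcnj l3 * (of_real y * l1 + qcnj h * l2 + l3)"
    unfolding v_def herm_comb[OF assms(1)] ..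
  finally show ?thesis
    by (simp only: gram_form_square)
qed

text \<open>A positive \<open>gram_det\<close> makes the Gram form definite on the span of all three vectors, or
  negative definite on the part of it orthogonal to \<open>p1\<close>; either contradicts the signature
  \<open>(2, 1)\<close> of \<open>herm\<close>.\<close>

lemma has_gram_imp_det_nonpos:
  assumes g: "has_gram x y h p1 p2 p3"
  shows "gram_det x y h \<le> 0"
proof (rule ccontr)
  assume "\<not> gram_det x y h \<le> 0"
  then have D: "gram_det x y h > 0"
    by simp
  \<comment> \<open>Otherwise the Schur formula makes \<open>gram_det\<close> minus a
    square.\<close>
  then have a: "1 - x\<^sup>2 \<noteq> 0"
    by (auto simp: gram_det_schur)
  \<comment> \<open>Three nonnegative terms with sum at most 0 all vanish, which kills
    \<open>l3\<close>, \<open>l2\<close>, \<open>l1\<close> in turn. The premises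
    \<open>orth\<close> and \<open>l1\<close> let one argument serve both signs of
    \<open>1 - x\<^sup>2\<close>.\<close>
  have contra: False if l: "l1 \<noteq> 0 \<or> l2 \<noteq> 0 \<or> l3 \<noteq> 0"
    and orth: "(1 - x\<^sup>2) * (norm (l1 + of_real x * l2 + of_real y * l3))\<^sup>2 \<ge> 0"
    and sign: "(1 - x\<^sup>2) * qre (herm (p1 \<cdot> l1 + p2 \<cdot> l2 + p3 \<cdot> l3) (p1 \<cdot> l1 + p2 \<cdot> l2 + p3 \<cdot> l3)) \<le> 0"
    and l1: "(1 - x\<^sup>2) * (norm (l1 + of_real x * l2 + of_real y * l3))\<^sup>2 = 0
      \<Longrightarrow> l1 + of_real x * l2 + of_real y * l3 = 0" for l1 l2 l3
  proof -
    let ?N = "(norm (of_real (1 - x\<^sup>2) * l2 + (h - of_real (x * y)) * l3))\<^sup>2"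
    have "gram_det x y h * (norm l3)\<^sup>2 \<ge> 0" "?N \<ge> 0"
      using D by simp_all
    then have z: "(1 - x\<^sup>2) * (norm (l1 + of_real x * l2 + of_real y * l3))\<^sup>2 = 0"
      "?N = 0" "gram_det x y h * (norm l3)\<^sup>2 = 0"
      using sign orth unfolding herm_comb_square[OF g] by linarith+
    have "l3 = 0"
      using z(3) D by simp
    moreover from this have "of_real (1 - x\<^sup>2) * l2 = 0"
      using z(2) by (simp del: of_real_diff of_real_power)
    then have "l2 = 0"
      using a by (simp del: of_real_diff of_real_power)
    ultimately show False
      using l1[OF z(1)] l by simp
  qed
  show False
  proof (cases "1 - x\<^sup>2 > 0")
    case True
    \<comment> \<open>Killing both positive coordinates makes the form nonpositive on this
      combination.\<close>
    obtain l1 l2 l3 where l: "l1 \<noteq> 0 \<or> l2 \<noteq> 0 \<or> l3 \<noteq> 0"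
      "p1 $ 1 * l1 + p2 $ 1 * l2 + p3 $ 1 * l3 = 0" "p1 $ 2 * l1 + p2 $ 2 * l2 + p3 $ 2 * l3 = 0"
      by (rule kernel_2_3)
    show False
    proof (rule contra[OF l(1)])
      show "(1 - x\<^sup>2) * qre (herm (p1 \<cdot> l1 + p2 \<cdot> l2 + p3 \<cdot> l3) (p1 \<cdot> l1 + p2 \<cdot> l2 + p3 \<cdot> l3)) \<le> 0"
        using True l(2,3) by (simp add: qre_herm_self mult_nonneg_nonpos)
    qed (use True in auto)
  next
    case False
    with a have neg: "1 - x\<^sup>2 < 0"
      by linarith
    \<comment> \<open>The first equation is orthogonality to \<open>p1\<close> and removes the
      square with negative coefficient; the second kills the negative coordinate, so the form is
      nonnegative here.\<close>
    obtain l1 l2 l3 where l: "l1 \<noteq> 0 \<or> l2 \<noteq> 0 \<or> l3 \<noteq> 0"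
      "1 * l1 + of_real x * l2 + of_real y * l3 = 0" "p1 $ 3 * l1 + p2 $ 3 * l2 + p3 $ 3 * l3 = 0"
      by (rule kernel_2_3)
    show False
    proof (rule contra[OF l(1)])
      show "(1 - x\<^sup>2) * qre (herm (p1 \<cdot> l1 + p2 \<cdot> l2 + p3 \<cdot> l3) (p1 \<cdot> l1 + p2 \<cdot> l2 + p3 \<cdot> l3)) \<le> 0"
        using neg l(3) by (simp add: qre_herm_self mult_nonpos_nonneg)
    qed (use l(2) in auto)
  qed
qed

text \<open>Pairing a dependence with each vector gives a kernel vector of the Gram matrix;
  eliminating \<open>l1\<close> leaves one of the Schur complement.\<close>

lemma right_dependent_imp_det_0:
  assumes g: "has_gram x y h p1 p2 p3" and "right_dependent p1 p2 p3"
  shows "gram_det x y h = 0"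
proof (rule ccontr)
  assume D: "gram_det x y h \<noteq> 0"
  obtain l1 l2 l3 where l: "\<not> (l1 = 0 \<and> l2 = 0 \<and> l3 = 0)" "p1 \<cdot> l1 + p2 \<cdot> l2 + p3 \<cdot> l3 = 0"
    using assms(2) unfolding right_dependent_def norm_sum3_eq_0_iff by blast
  have e: "l1 + of_real x * l2 + of_real y * l3 = 0" "of_real x * l1 + l2 + h * l3 = 0"
    "of_real y * l1 + qcnj h * l2 + l3 = 0"
    unfolding herm_comb[OF g, of l1 l2 l3, symmetric] l(2) by (simp_all add: herm_def)
  let ?a = "of_real (1 - x\<^sup>2) :: quat" and ?b = "of_real (1 - y\<^sup>2) :: quat"
    and ?c = "h - of_real (x * y)"
  have l1: "l1 = - (of_real x * l2 + of_real y * l3)"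
    using e(1) by (simp only: eq_neg_iff_add_eq_0 add.assoc)
  have e2: "?a * l2 + ?c * l3 = 0" and e3: "qcnj ?c * l2 + ?b * l3 = 0"
    using e(2,3) by (simp_all add: l1 algebra_simps power2_eq_square quat_eq_iff)
  \<comment> \<open>The adjugate of the Schur complement isolates the determinant times one
    coefficient.\<close>
  have "of_real (gram_det x y h) * l3 = ?a * (qcnj ?c * l2 + ?b * l3) - qcnj ?c * (?a * l2 + ?c * l3)"
    unfolding gram_det_schur norm_quat_sq
    by (simp add: quat_eq_iff del: of_real_mult of_real_diff of_real_power of_real_add) algebra
  then have "l3 = 0"
    using D e2 e3 by simp
  have "of_real (gram_det x y h) * l2 = ?b * (?a * l2 + ?c * l3) - ?c * (qcnj ?c * l2 + ?b * l3)"
    unfolding gram_det_schur norm_quat_sq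
    by (simp add: quat_eq_iff del: of_real_mult of_real_diff of_real_power of_real_add) algebra
  then have "l2 = 0"
    using D e2 e3 by simp
  with \<open>l3 = 0\<close> l1 l(1) show False
    by simp
qed

text \<open>Choose a coordinate \<open>k\<close> where \<open>v\<close> is nonzero. A combination
  vanishing in the other two coordinates is still orthogonal to \<open>v\<close>, which forces
  coordinate \<open>k\<close> to vanish too.\<close>

lemma right_dependent_if_orthogonal:
  assumes v: "v \<noteq> 0" and orth: "herm p1 v = 0" "herm p2 v = 0" "herm p3 v = 0"
  shows "right_dependent p1 p2 p3"
proof -
  obtain k where k: "v $ k \<noteq> 0"
    using v by (auto simp: vec_eq_iff)
  have "UNIV = {2, 3, k} \<or> UNIV = {1, 3, k} \<or> UNIV = {1, 2, k}"
    using exhaust_3[of k] by (elim disjE) (simp_all add: UNIV_3 insert_commute)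
  then obtain i j :: 3 where ij: "UNIV = {i, j, k}"
    by blast
  obtain l1 l2 l3 where l: "l1 \<noteq> 0 \<or> l2 \<noteq> 0 \<or> l3 \<noteq> 0"
    "p1 $ i * l1 + p2 $ i * l2 + p3 $ i * l3 = 0" "p1 $ j * l1 + p2 $ j * l2 + p3 $ j * l3 = 0"
    by (rule kernel_2_3)
  let ?w = "p1 \<cdot> l1 + p2 \<cdot> l2 + p3 \<cdot> l3"
  have off: "?w $ m = 0" if "m \<noteq> k" for m
  proof -
    have "m = i \<or> m = j"
      using UNIV_I[of m] that unfolding ij by blast
    then show ?thesis
      using l(2,3) by auto
  qed
  have "herm ?w v = 0"
    using orth by (simp add: herm_sesqui)
  then have "qcnj (v $ k) * ?w $ k = 0"
    using exhaust_3[of k] off[of 1] off[of 2] off[of 3] unfolding herm_def by auto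
  then have "?w $ k = 0"
    using k by simp
  then have "?w = 0"
    using off by (metis vec_eq_iff zero_index)
  moreover have "norm l1 + norm l2 + norm l3 \<noteq> 0"
    using l(1) unfolding norm_sum3_eq_0_iff by blast
  ultimately show ?thesis
    unfolding right_dependent_def by blast
qed

lemma det_0_imp_right_dependent:
  assumes g: "has_gram x y h p1 p2 p3" and D: "gram_det x y h = 0"
  shows "right_dependent p1 p2 p3"
proof -
  let ?a = "of_real (1 - x\<^sup>2) :: quat" and ?b = "of_real (1 - y\<^sup>2) :: quat"
    and ?c = "h - of_real (x * y)"
  have cc: "qcnj ?c * ?c = ?a * ?b"
    using D unfolding gram_det_schur qcnj_mult_self of_real_mult[symmetric] by simp
  \<comment> \<open>A kernel vector of the singular Schur complement: \<open>(- ?c, ?a)\<close>, or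
    \<open>(1, 0)\<close> when \<open>?a = 0\<close>, which forces \<open>?c = 0\<close>.\<close>
  have "\<exists>l2 l3. \<not> (l2 = 0 \<and> l3 = 0) \<and> ?a * l2 + ?c * l3 = 0 \<and> qcnj ?c * l2 + ?b * l3 = 0"
  proof (cases "?a = 0")
    case True
    then have "?c = 0"
      using cc by (metis mult_eq_0_iff qcnj_eq_0_iff)
    with True show ?thesis
      by (intro exI[of _ 1] exI[of _ 0]) simp
  next
    case False
    have "?a * (- ?c) + ?c * ?a = 0"
      by (simp add: quat_eq_iff mult.commute[of "1 - x\<^sup>2"] algebra_simps
          del: of_real_diff of_real_power of_real_mult)
    moreover have "qcnj ?c * (- ?c) + ?b * ?a = 0"
      by (simp only: mult_minus_right cc) (simp only: mult.commute add.left_inverse flip: of_real_mult)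
    ultimately show ?thesis
      using False by blast
  qed
  then obtain l2 l3 where l: "\<not> (l2 = 0 \<and> l3 = 0)" "?a * l2 + ?c * l3 = 0" "qcnj ?c * l2 + ?b * l3 = 0"
    by blast
  \<comment> \<open>This choice makes \<open>v\<close> orthogonal to \<open>p1\<close>; the two
    equations for \<open>l2\<close> and \<open>l3\<close> then give \<open>p2\<close> and
    \<open>p3\<close>.\<close>
  define l1 where "l1 = - (of_real x * l2 + of_real y * l3)"
  define v where "v = p1 \<cdot> l1 + p2 \<cdot> l2 + p3 \<cdot> l3"
  have "herm v p1 = 0" "herm v p2 = 0" "herm v p3 = 0"
    using l(2,3) unfolding v_def herm_comb[OF g]
    by (simp_all add: l1_def algebra_simps power2_eq_square quat_eq_iff)
  then have orth: "herm p1 v = 0" "herm p2 v = 0" "herm p3 v = 0"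
    using herm_eq_0_sym by blast+
  show ?thesis
  proof (cases "v = 0")
    case True
    then show ?thesis
      using l(1) unfolding right_dependent_def norm_sum3_eq_0_iff v_def by blast
  next
    case False
    then show ?thesis
      using orth by (rule right_dependent_if_orthogonal)
  qed
qed

text \<open>For nonzero \<open>a\<close>, put \<open>u\<close> on the axis matching its sign. The
  pairing fixes one coordinate of \<open>v\<close>, and the hypothesis gives the other, which
  corrects the norm, a real square root.\<close>

lemma gram_realization_1_1:
  assumes "a * b \<le> (norm (c::quat))\<^sup>2"
  obtains (realize) u1 u2 v1 v2 where
    "qcnj u1 * u1 - qcnj u2 * u2 = of_real a" "qcnj v1 * v1 - qcnj v2 * v2 = of_real b"
    "qcnj u1 * v1 - qcnj u2 * v2 = c"
proof -
  have *: thesis if "(norm u1)\<^sup>2 - (norm u2)\<^sup>2 = a" "(norm v1)\<^sup>2 - (norm v2)\<^sup>2 = b"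
    "qcnj u1 * v1 - qcnj u2 * v2 = c" for u1 u2 v1 v2
    using that(3)
    by (rule realize[rotated 2]) (simp_all only: qcnj_mult_self that(1,2) flip: of_real_diff)
  consider "a > 0" | "a < 0" | "a = 0" "c \<noteq> 0" | "a = 0" "c = 0"
    by linarith
  then show thesis
  proof cases
    case 1
    define s where "s = sqrt a"
    have s: "s > 0" "a = s\<^sup>2"
      using 1 by (simp_all add: s_def)
    have "(norm c)\<^sup>2 / a - b \<ge> 0"
      using assms 1 by (simp add: field_simps)
    then show thesis
      using s by (intro *[of "of_real s" 0 "inverse s *\<^sub>R c" "of_real (sqrt ((norm c)\<^sup>2 / a - b))"])
        (simp_all add: power_mult_distrib power_inverse divide_inverse flip: scaleR_conv_of_real)
  next
    case 2
    define s where "s = sqrt (- a)"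
    have s: "s > 0" "a = - s\<^sup>2"
      using 2 by (simp_all add: s_def)
    have "b - (norm c)\<^sup>2 / a \<ge> 0"
      using assms 2 by (simp add: field_simps)
    then show thesis
      using s by (intro *[of 0 "of_real s" "of_real (sqrt (b - (norm c)\<^sup>2 / a))" "- (inverse s *\<^sub>R c)"])
        (simp_all add: power_mult_distrib power_inverse divide_inverse flip: scaleR_conv_of_real)
  next
    case 3
    \<comment> \<open>With the isotropic \<open>u = (1, 1)\<close>, adding
      \<open>t *\<^sub>R c\<close> to both coordinates of \<open>v = (c, 0)\<close> keeps the
      pairing; \<open>t\<close> solves \<open>(1 + 2 * t) * (norm c)\<^sup>2 = b\<close>.\<close>
    define t where "t = (b - (norm c)\<^sup>2) / (2 * (norm c)\<^sup>2)"
    have "(norm ((1 + t) *\<^sub>R c))\<^sup>2 - (norm (t *\<^sub>R c))\<^sup>2 = (1 + 2 * t) * (norm c)\<^sup>2"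
      unfolding norm_scaleR power_mult_distrib power2_abs by algebra
    also have "\<dots> = b"
      using 3 by (simp add: t_def field_simps)
    finally show thesis
      using 3 by (intro *[of 1 1 "(1 + t) *\<^sub>R c" "t *\<^sub>R c"]) (simp_all add: algebra_simps)
  next
    case 4
    then show thesis
      \<comment> \<open>Here \<open>u\<close> is zero and \<open>v\<close> lies on the axis matching
        the sign of \<open>b\<close>.\<close>
      by (intro *[of 0 0 "of_real (sqrt (max b 0))" "of_real (sqrt (max (- b) 0))"])
        (auto simp: max_def)
  qed
qed

text \<open>With \<open>p1\<close> the first basis vector, the first coordinates of
  \<open>p2\<close> and \<open>p3\<close> must be \<open>x\<close> and \<open>y\<close>. The
  remaining coordinates, of signature (1, 1), must realize the Schur complement.\<close>

lemma gram_realization: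
  assumes "gram_det x y h \<le> 0"
  obtains p1 p2 p3 where "has_gram x y h p1 p2 p3"
proof -
  have "(1 - x\<^sup>2) * (1 - y\<^sup>2) \<le> (norm (h - of_real (x * y)))\<^sup>2"
    using assms by (simp add: gram_det_schur)
  then obtain u1 u2 v1 v2 where uv:
    "qcnj u1 * u1 - qcnj u2 * u2 = of_real (1 - x\<^sup>2)"
    "qcnj v1 * v1 - qcnj v2 * v2 = of_real (1 - y\<^sup>2)"
    "qcnj u1 * v1 - qcnj u2 * v2 = h - of_real (x * y)"
    by (rule gram_realization_1_1)
  let ?p1 = "vector [1, 0, 0] :: quat ^ 3" and ?p2 = "vector [of_real x, u1, u2] :: quat ^ 3"
    and ?p3 = "vector [of_real y, v1, v2] :: quat ^ 3"
  have "herm ?p2 ?p2 = 1" "herm ?p3 ?p3 = 1" "herm ?p3 ?p2 = h"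
    using uv by (simp_all add: herm_def add_diff_eq[symmetric] power2_eq_square)
  then have "has_gram x y h ?p1 ?p2 ?p3"
    by (simp add: has_gram_def herm_def)
  then show ?thesis
    by (rule that)
qed

section \<open>Triangles\<close>

lemma exp_i_times_of_real:
  "exp (\<i> * of_real A) = cis A" "exp (- (\<i> * of_real A)) = cis (- A)"
  by (simp_all add: cis_conv_exp)

lemma gram_eq_G_matrix_iff:
  "gram p1 p2 p3 = (\<chi> i j. quat_of_complex (G_matrix r1 r2 r3 A $ i $ j))
    \<longleftrightarrow> has_gram r3 r2 (quat_of_complex (of_real r1 * cis A)) p1 p2 p3"
    (is "?L \<longleftrightarrow> has_gram r3 r2 ?h p1 p2 p3")
proof -
  have cnj: "quat_of_complex (of_real r1 * cis (- A)) = qcnj ?h"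
    by (simp add: quat_of_complex_def quat_eq_iff)
  have real: "quat_of_complex (of_real r) = of_real r" "quat_of_complex 1 = 1" for r
    by (simp_all add: quat_of_complex_def quat_eq_iff)
  have "?L \<longleftrightarrow>
    (herm p1 p1 = 1 \<and> herm p2 p1 = of_real r3 \<and> herm p3 p1 = of_real r2) \<and>
    (herm p1 p2 = of_real r3 \<and> herm p2 p2 = 1 \<and> herm p3 p2 = ?h) \<and>
    (herm p1 p3 = of_real r2 \<and> herm p2 p3 = qcnj ?h \<and> herm p3 p3 = 1)"
    by (simp add: vec_eq_iff forall_3 gram_def Let_def G_matrix_def exp_i_times_of_real cnj real)
  also have "\<dots> \<longleftrightarrow> has_gram r3 r2 ?h p1 p2 p3"
    unfolding has_gram_def by (metis qcnj_herm qcnj_of_real)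
  finally show ?thesis .
qed

text \<open>Normalization is the diagonal of \<open>has_gram\<close>, and the polar vectors
  themselves witness that the sets are lines.\<close>

lemma rA_triangle_iff:
  "rA_triangle r1 r2 r3 A (l1, l2, l3) \<longleftrightarrow>
    (\<exists>p1 p2 p3. polar_vector p1 l1 \<and> polar_vector p2 l2 \<and> polar_vector p3 l3 \<and>
       has_gram r3 r2 (quat_of_complex (of_real r1 * cis A)) p1 p2 p3)"
  unfolding rA_triangle_def gram_eq_G_matrix_iff hyp_triangle_def quat_line_def
    normalized_polar_vector_def has_gram_def prod.case
  by blast

lemma polar_vector_of_unit:
  assumes "herm p p = 1"
  shows "polar_vector p (proj (perp p) \<inter> hyp_plane)"
  using assms by (simp add: polar_vector_def V_pos_def)

lemma gram_det_cis:
  "gram_det r3 r2 (quat_of_complex (of_real r1 * cis A))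
    = 1 - (r1\<^sup>2 + r2\<^sup>2 + r3\<^sup>2) + 2 * r1 * r2 * r3 * cos A"
proof -
  have "(norm (quat_of_complex (of_real r1 * cis A)))\<^sup>2 = r1\<^sup>2 * ((cos A)\<^sup>2 + (sin A)\<^sup>2)"
    unfolding norm_quat_sq by (simp add: quat_of_complex_def power_mult_distrib distrib_left
        del: sin_cos_squared_add sin_cos_squared_add2)
  then show ?thesis
    by (simp add: gram_det_def quat_of_complex_def)
qed

lemma det_G_matrix:
  "det (G_matrix r1 r2 r3 A)
    = complex_of_real (1 - (r1\<^sup>2 + r2\<^sup>2 + r3\<^sup>2) + 2 * r1 * r2 * r3 * cos A)"
proof -
  have cs: "cis A * cis (- A) = 1" "cis A + cis (- A) = 2 * of_real (cos A)"
    by (simp_all add: cis_mult complex_eq_iff)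
  \<comment> \<open>Grouped so that \<open>A\<close> enters only through the product and the sum of
    conjugate phases.\<close>
  have "det (G_matrix r1 r2 r3 A) = 1 - of_real r1 ^ 2 * (cis A * cis (- A)) - of_real r2 ^ 2
      - of_real r3 ^ 2 + of_real r1 * of_real r2 * of_real r3 * (cis A + cis (- A))"
    by (simp add: det_3 G_matrix_def exp_i_times_of_real power2_eq_square algebra_simps)
  also have "\<dots> = complex_of_real (1 - (r1\<^sup>2 + r2\<^sup>2 + r3\<^sup>2) + 2 * r1 * r2 * r3 * cos A)"
    unfolding cs by (simp add: algebra_simps)
  finally show ?thesis .
qed

theorem theorem8p1:
  fixes A r1 r2 r3 :: real
  assumes "0 \<le> A" and "A \<le> pi / 2"
    and "0 \<le> r1" and "0 \<le> r2" and "0 \<le> r3"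
  shows "det (G_matrix r1 r2 r3 A)
           = complex_of_real (1 - (r1\<^sup>2 + r2\<^sup>2 + r3\<^sup>2) + 2 * r1 * r2 * r3 * cos A)
    \<and> ((\<exists>l1 l2 l3. rA_triangle r1 r2 r3 A (l1, l2, l3)) \<longleftrightarrow>
          1 - (r1\<^sup>2 + r2\<^sup>2 + r3\<^sup>2) + 2 * r1 * r2 * r3 * cos A \<le> 0)
    \<and> (\<forall>l1 l2 l3 p1 p2 p3.
          rA_triangle r1 r2 r3 A (l1, l2, l3) \<and>
          polar_vector p1 l1 \<and> polar_vector p2 l2 \<and> polar_vector p3 l3 \<longrightarrow>
          (det (G_matrix r1 r2 r3 A) = 0 \<longleftrightarrow>
            (\<exists>q1 q2 q3. norm q1 + norm q2 + norm q3 \<noteq> 0 \<and>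
               p1 \<cdot> q1 + p2 \<cdot> q2 + p3 \<cdot> q3 = 0)))"
proof -
  let ?h = "quat_of_complex (of_real r1 * cis A)"
  have D: "det (G_matrix r1 r2 r3 A) = of_real (gram_det r3 r2 ?h)"
    unfolding det_G_matrix gram_det_cis ..
  have "(\<exists>l1 l2 l3. rA_triangle r1 r2 r3 A (l1, l2, l3)) \<longleftrightarrow> gram_det r3 r2 ?h \<le> 0"
  proof
    assume "\<exists>l1 l2 l3. rA_triangle r1 r2 r3 A (l1, l2, l3)"
    then show "gram_det r3 r2 ?h \<le> 0"
      unfolding rA_triangle_iff using has_gram_imp_det_nonpos by blast
  next
    assume "gram_det r3 r2 ?h \<le> 0"
    then obtain p1 p2 p3 where "has_gram r3 r2 ?h p1 p2 p3"
      by (rule gram_realization)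
    moreover from this have "herm p1 p1 = 1" "herm p2 p2 = 1" "herm p3 p3 = 1"
      by (simp_all add: has_gram_def)
    ultimately show "\<exists>l1 l2 l3. rA_triangle r1 r2 r3 A (l1, l2, l3)"
      unfolding rA_triangle_iff by (blast intro: polar_vector_of_unit)
  qed
  moreover have "det (G_matrix r1 r2 r3 A) = 0 \<longleftrightarrow> right_dependent p1 p2 p3"
    if t: "rA_triangle r1 r2 r3 A (l1, l2, l3)"
      and p: "polar_vector p1 l1" "polar_vector p2 l2" "polar_vector p3 l3" for l1 l2 l3 p1 p2 p3
  proof -
    obtain n1 n2 n3 where n: "polar_vector n1 l1" "polar_vector n2 l2" "polar_vector n3 l3"
      and g: "has_gram r3 r2 ?h n1 n2 n3"
      using t unfolding rA_triangle_iff by blast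
    have "right_dependent p1 p2 p3 \<longleftrightarrow> right_dependent n1 n2 n3"
      using right_dependent_polar[OF p n] right_dependent_polar[OF n p] by blast
    also have "\<dots> \<longleftrightarrow> gram_det r3 r2 ?h = 0"
      using right_dependent_imp_det_0[OF g] det_0_imp_right_dependent[OF g] by blast
    finally show ?thesis
      unfolding D by simp
  qed
  ultimately show ?thesis
    unfolding gram_det_cis right_dependent_def by (intro conjI allI impI det_G_matrix) blast+
qed

end
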